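(* Let $(X,Y,Z)$ be random variables with an arbitrary joint distribution $P_{X,Y,Z}$ on finite alphabets. Assume that there exists an auxiliary random variable $T$ on some (finite) alphabet, jointly distributed with $(X,Y,Z)$ (i.e. given by some $P_{T|X,Y,Z}$), such that $$I(T;Z|X,Y)=I(X;Y|T)=I(T;Z)=0 .$$ Then $\hat{\Psi}(X;Y\|Z)=I(X;Y)$.
   Context: All random variables have finite alphabets. $H$ and $I$ denote Shannon entropy and (conditional) mutual information. For $(X,Y,Z)\sim P_{X,Y,Z}$, define $$\hat{\Psi}(X;Y\|Z)\triangleq\min_{J}\; \big[I(X;Y|J)+I(X,Y;J|Z)\big],$$ where the minimum is over all finite-alphabet random variables $J$ jointly distributed with $(X,Y,Z)$, i.e. over all conditional distributions $P_{J|X,Y,Z}$. *)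

theory Defs
  imports "HOL-Probability.Probability"
begin

text \<open>
  Random variables are functions on the sample space of a probability mass function, with values
  in countable alphabets, each carrying its full power set as sigma-algebra. Entropic quantities
  are the library's, to base \<open>b\<close>.
\<close>

definition MI :: "real \<Rightarrow> 'w pmf \<Rightarrow> ('w \<Rightarrow> 'a) \<Rightarrow> ('w \<Rightarrow> 'b) \<Rightarrow> real" where
  "MI b p A B =
     prob_space.mutual_information (measure_pmf p) b (count_space UNIV) (count_space UNIV) A B"

definition CMI ::
    "real \<Rightarrow> 'w pmf \<Rightarrow> ('w \<Rightarrow> 'a) \<Rightarrow> ('w \<Rightarrow> 'b) \<Rightarrow> ('w \<Rightarrow> 'c) \<Rightarrow> real" where
  "CMI b p A B C =
     prob_space.conditional_mutual_information (measure_pmf p) b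
       (count_space UNIV) (count_space UNIV) (count_space UNIV) A B C"

definition adjoin :: "'w pmf \<Rightarrow> ('w \<Rightarrow> 'u pmf) \<Rightarrow> ('w \<times> 'u) pmf" where
  "adjoin P K = bind_pmf P (\<lambda>w. map_pmf (Pair w) (K w))"

text \<open>
  The variable \<open>J\<close> ranges over all conditional distributions of finite support on the natural
  numbers. As the alphabets of \<open>X\<close>, \<open>Y\<close>, \<open>Z\<close> are finite, this covers, up to renaming of
  symbols, every finite alphabet for \<open>J\<close>.
  The use of \<open>LEAST\<close> rather than \<open>Inf\<close> renders a minimum, which has to be attained: an equation
  \<open>psi_hat b P = v\<close> is established by showing that \<open>v\<close> is a member and a lower bound of the set
  of achievable values.
\<close>

definition psi_hat :: "real \<Rightarrow> ('x::finite \<times> 'y::finite \<times> 'z::finite) pmf \<Rightarrow> real" where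
  "psi_hat b P =
     (LEAST v. \<exists>J :: 'x \<times> 'y \<times> 'z \<Rightarrow> nat pmf.
        (\<forall>w. finite (set_pmf (J w))) \<and>
        v = CMI b (adjoin P J) (\<lambda>((x, y, z), j). x) (\<lambda>((x, y, z), j). y) (\<lambda>((x, y, z), j). j)
          + CMI b (adjoin P J) (\<lambda>((x, y, z), j). (x, y)) (\<lambda>((x, y, z), j). j) (\<lambda>((x, y, z), j). z))"

end

theory Submission
  imports Defs
begin

text \<open>
  A constant \<open>J\<close> attains \<open>I(X;Y)\<close>. For the lower bound, given \<open>J\<close>, resample \<open>T\<close> from its conditional
  distribution given \<open>(X,Y,Z)\<close>, independently of \<open>J\<close>. Together with \<open>I(T;Z|X,Y) = 0\<close> this gives
  \<open>I(T;J,Z|X,Y) = 0\<close>, and then, using \<open>I(X;Y|T) = I(T;Z) = 0\<close>, expansion into joint entropies yields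
  \<open>I(X;Y|J) + I(X,Y;J|Z) - I(X;Y)
    = I(X;Y|T,J) + I(T;J|X) + I(T;J|Y) + I(X,Y;J|T,Z) + I(T;Z|J) \<ge> 0\<close>.
\<close>

section \<open>Entropy on a pmf as an expected negative log-probability\<close>

abbreviation ent :: "real \<Rightarrow> 'w pmf \<Rightarrow> ('w \<Rightarrow> 'a) \<Rightarrow> real" where
  "ent b p A \<equiv> prob_space.entropy (measure_pmf p) b (count_space UNIV) A"

lemma information_space_measure_pmf: "1 < b \<Longrightarrow> information_space (measure_pmf p) b"
  by (simp add: information_space_def information_space_axioms_def measure_pmf.prob_space_axioms)

lemma distributed_map_pmf:
  "distributed (measure_pmf p) (count_space UNIV) A (\<lambda>a. ennreal (pmf (map_pmf A p) a))"
  unfolding distributed_def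
  by (simp flip: map_pmf_rep_eq measure_pmf_eq_density)

text \<open>Finite support makes the log-probability integrable; this is the premise that the
  library's nonnegativity theorem asks for in \<open>CMI_nonneg\<close>.\<close>

lemma finite_entropy_measure_pmf:
  assumes "1 < b" "finite (set_pmf p)"
  shows "information_space.finite_entropy (measure_pmf p) b (count_space UNIV) A (pmf (map_pmf A p))"
proof -
  interpret information_space "measure_pmf p" b
    using assms(1) by (rule information_space_measure_pmf)
  have "integrable (measure_pmf (map_pmf A p)) (\<lambda>a. log b (pmf (map_pmf A p) a))"
    by (rule integrable_measure_pmf_finite) (simp add: assms(2))
  then have "integrable (count_space UNIV) (\<lambda>a. pmf (map_pmf A p) a * log b (pmf (map_pmf A p) a))"
    by (simp add: measure_pmf_eq_density integrable_density)
  then show ?thesis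
    by (simp add: finite_entropy_def distributed_map_pmf)
qed

text \<open>Change of variables moves the sum over the alphabet to the sample space. Entropies of
  different variables then become integrals against the same measure and can be added or subtracted
  under one integral sign.\<close>

lemma ent_eq_expectation:
  assumes "1 < b"
  shows "ent b p A = (\<integral>w. - log b (pmf (map_pmf A p) (A w)) \<partial>measure_pmf p)"
proof -
  interpret information_space "measure_pmf p" b
    using assms by (rule information_space_measure_pmf)
  have "ent b p A = - (\<integral>a. pmf (map_pmf A p) a * log b (pmf (map_pmf A p) a) \<partial>count_space UNIV)"
    by (rule entropy_distr[OF distributed_map_pmf]) simp
  also have "\<dots> = - (\<integral>a. log b (pmf (map_pmf A p) a) \<partial>measure_pmf (map_pmf A p))"
    by (simp only: measure_pmf_eq_density) (simp add: integral_density)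
  finally show ?thesis
    by simp
qed

lemma ent_map_pmf:
  assumes "1 < b"
  shows "ent b (map_pmf f p) A = ent b p (\<lambda>w. A (f w))"
  using assms by (simp add: ent_eq_expectation map_pmf_comp)

text \<open>Entropy sees only the partition of the sample space into fibres. This justifies every
  reordering, regrouping or dropping of redundant tuple components below.\<close>

lemma ent_cong_kernel:
  assumes "1 < b" and "\<And>v w. A v = A w \<longleftrightarrow> B v = B w"
  shows "ent b p A = ent b p B"
proof -
  have "A -` {A w} = B -` {B w}" for w
    using assms(2) by auto
  then show ?thesis
    using assms(1) by (simp add: ent_eq_expectation pmf_map)
qed

lemma ent_const: "1 < b \<Longrightarrow> ent b p (\<lambda>w. c) = 0"
  by (simp add: ent_eq_expectation map_pmf_const)

section \<open>Mutual information as a linear combination of joint entropies\<close>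

lemma count_space_pair:
  "count_space UNIV \<Otimes>\<^sub>M count_space UNIV = count_space (UNIV :: ('a::countable \<times> 'b::countable) set)"
  by (simp add: pair_measure_countable)

lemma MI_eq_ent:
  fixes A :: "'w \<Rightarrow> 'a::countable" and B :: "'w \<Rightarrow> 'b::countable"
  assumes b: "1 < b" and fin: "finite (set_pmf p)"
  shows "MI b p A B = ent b p A + ent b p B - ent b p (\<lambda>w. (A w, B w))"
proof -
  interpret information_space "measure_pmf p" b
    using b by (rule information_space_measure_pmf)
  let ?A = "pmf (map_pmf A p)" and ?B = "pmf (map_pmf B p)"
  let ?AB = "pmf (map_pmf (\<lambda>w. (A w, B w)) p)"
  \<comment> \<open>The logarithm of the quotient splits only where all three probabilities are
    positive, which holds on the support of \<open>p\<close>.\<close>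
  have pos: "0 < pmf (map_pmf F p) (F w)" if "w \<in> set_pmf p" for F :: "'w \<Rightarrow> 'e" and w
    using that by (simp add: pmf_positive)
  have "MI b p A B = (\<integral>x. ?AB x * log b (?AB x / (?A (fst x) * ?B (snd x)))
      \<partial>(count_space UNIV \<Otimes>\<^sub>M count_space UNIV))"
    unfolding MI_def
    by (rule mutual_information_distr[OF _ _ distributed_map_pmf _ distributed_map_pmf])
      (simp_all add: sigma_finite_measure_count_space count_space_pair distributed_map_pmf)
  also have "\<dots> = (\<integral>x. log b (?AB x / (?A (fst x) * ?B (snd x))) \<partial>map_pmf (\<lambda>w. (A w, B w)) p)"
    by (simp only: measure_pmf_eq_density count_space_pair) (simp add: integral_density)
  also have "\<dots> = (\<integral>w. log b (?AB (A w, B w)) - log b (?A (A w)) - log b (?B (B w)) \<partial>p)"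
    by (simp, rule integral_cong_AE)
      (auto simp: AE_measure_pmf_iff log_divide log_mult dest: pos[of _ A] pos[of _ B] pos[of _ "\<lambda>w. (A w, B w)"])
  also have "\<dots> = ent b p A + ent b p B - ent b p (\<lambda>w. (A w, B w))"
    by (simp add: ent_eq_expectation b integrable_measure_pmf_finite fin)
  finally show ?thesis .
qed

lemma CMI_eq_ent:
  fixes A :: "'w \<Rightarrow> 'a::countable" and B :: "'w \<Rightarrow> 'b::countable" and C :: "'w \<Rightarrow> 'c::countable"
  assumes b: "1 < b" and fin: "finite (set_pmf p)"
  shows "CMI b p A B C = ent b p (\<lambda>w. (A w, C w)) + ent b p (\<lambda>w. (B w, C w))
    - ent b p (\<lambda>w. (A w, B w, C w)) - ent b p C"
proof -
  interpret information_space "measure_pmf p" b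
    using b by (rule information_space_measure_pmf)
  \<comment> \<open>The library defines conditional mutual information by the chain rule, as exactly
    this difference.\<close>
  have "CMI b p A B C = MI b p A (\<lambda>w. (B w, C w)) - MI b p A C"
    unfolding CMI_def MI_def prob_space.conditional_mutual_information_def[OF measure_pmf.prob_space_axioms] count_space_pair ..
  then show ?thesis
    by (simp add: MI_eq_ent assms)
qed

lemma CMI_nonneg:
  fixes A :: "'w \<Rightarrow> 'a::countable" and B :: "'w \<Rightarrow> 'b::countable" and C :: "'w \<Rightarrow> 'c::countable"
  assumes b: "1 < b" and fin: "finite (set_pmf p)"
  shows "0 \<le> CMI b p A B C"
proof -
  interpret information_space "measure_pmf p" b
    using b by (rule information_space_measure_pmf)
  note fe = finite_entropy_measure_pmf[OF assms]
  have sf: "sigma_finite_measure (count_space (UNIV :: 'd::countable set))"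
    by (simp add: sigma_finite_measure_count_space)
  show ?thesis
    unfolding CMI_def
    \<comment> \<open>The last three premises live on product spaces, so \<open>fe\<close> fits them
      only after the products are rewritten as counting spaces.\<close>
    by (rule conditional_mutual_information_generic_nonneg'
          [OF sf sf sf fe fe, unfolded count_space_pair, OF fe fe fe])
qed

section \<open>Adjoining a variable by a conditional distribution, and the chain rule\<close>

lemma pmf_adjoin: "pmf (adjoin P K) (w, u) = pmf P w * pmf (K w) u"
proof -
  have "pmf (map_pmf (Pair v) (K v)) (w, u) = indicator {w} v * pmf (K w) u" for v
  proof (cases "v = w")
    case True
    then show ?thesis
      by (simp add: pmf_map_inj' inj_on_def)
  next
    case False
    then have "(w, u) \<notin> set_pmf (map_pmf (Pair v) (K v))"
      by auto
    then show ?thesis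
      using False by (simp add: pmf_eq_0_set_pmf)
  qed
  then show ?thesis
    by (simp add: adjoin_def pmf_bind measure_pmf_single)
qed

lemma set_pmf_adjoin: "set_pmf (adjoin P K) = (SIGMA w : set_pmf P. set_pmf (K w))"
  by (auto simp: adjoin_def)

lemma finite_set_pmf_adjoin:
  "finite (set_pmf P) \<Longrightarrow> (\<And>w. finite (set_pmf (K w))) \<Longrightarrow> finite (set_pmf (adjoin P K))"
  by (simp add: set_pmf_adjoin)

lemma map_fst_adjoin: "map_pmf fst (adjoin P K) = P"
  by (simp add: adjoin_def map_bind_pmf map_pmf_comp bind_return_pmf')

text \<open>With \<open>f = fst\<close> this forgets \<open>J\<close> after \<open>T\<close> has
  been drawn by a kernel that ignores \<open>J\<close>, leaving the original joint law of
  \<open>(X,Y,Z)\<close> and \<open>T\<close>.\<close>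

lemma map_adjoin: "map_pmf (\<lambda>x. (f (fst x), snd x)) (adjoin P (\<lambda>w. K (f w))) = adjoin (map_pmf f P) K"
  by (simp add: adjoin_def map_bind_pmf bind_map_pmf map_pmf_comp)

text \<open>Chain rule H(W,U) = H(W) + H(U|W): on the support the log of the product
  \<open>pmf_adjoin\<close> splits, and the second part averages to the mean entropy of the
  kernels.\<close>

lemma ent_adjoin:
  assumes b: "1 < b" and fin: "finite (set_pmf P)" "\<And>w. finite (set_pmf (K w))"
  shows "ent b (adjoin P K) (\<lambda>x. x) = ent b P (\<lambda>w. w) + (\<integral>w. ent b (K w) (\<lambda>u. u) \<partial>P)"
proof -
  note int = integrable_measure_pmf_finite[OF finite_set_pmf_adjoin[OF fin]]
  have "ent b (adjoin P K) (\<lambda>x. x) = (\<integral>x. - log b (pmf (adjoin P K) x) \<partial>adjoin P K)"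
    by (simp add: ent_eq_expectation b)
  also have "\<dots> = (\<integral>x. - log b (pmf P (fst x)) - log b (pmf (K (fst x)) (snd x)) \<partial>adjoin P K)"
    by (rule integral_cong_AE)
      (auto simp: AE_measure_pmf_iff set_pmf_adjoin pmf_adjoin log_mult pmf_eq_0_set_pmf)
  also have "\<dots> = (\<integral>x. - log b (pmf P (fst x)) \<partial>adjoin P K)
      + (\<integral>x. - log b (pmf (K (fst x)) (snd x)) \<partial>adjoin P K)"
    by (simp add: int)
  also have "(\<integral>x. - log b (pmf P (fst x)) \<partial>adjoin P K) = (\<integral>w. - log b (pmf P w) \<partial>P)"
    by (subst (2) map_fst_adjoin[of P K, symmetric]) simp
  also have "(\<integral>x. - log b (pmf (K (fst x)) (snd x)) \<partial>adjoin P K)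
      = (\<integral>w. (\<integral>u. - log b (pmf (K w) u) \<partial>K w) \<partial>P)"
    unfolding adjoin_def
    by (subst pmf_expectation_bind[of "set_pmf P"])
      (simp_all add: fin integral_measure_pmf_real[of "set_pmf P"] mult.commute sum_negf)
  finally show ?thesis
    by (simp add: ent_eq_expectation b)
qed

section \<open>Transfer along maps, conditional independence of adjoined variables, and the entropy
  inequality\<close>

lemma CMI_map_pmf:
  fixes A :: "'w \<Rightarrow> 'a::countable" and B :: "'w \<Rightarrow> 'b::countable" and C :: "'w \<Rightarrow> 'c::countable"
  assumes "1 < b" and "finite (set_pmf p)"
  shows "CMI b (map_pmf f p) A B C = CMI b p (\<lambda>w. A (f w)) (\<lambda>w. B (f w)) (\<lambda>w. C (f w))"
  by (simp add: CMI_eq_ent ent_map_pmf assms)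

lemma MI_map_pmf:
  fixes A :: "'w \<Rightarrow> 'a::countable" and B :: "'w \<Rightarrow> 'b::countable"
  assumes "1 < b" and "finite (set_pmf p)"
  shows "MI b (map_pmf f p) A B = MI b p (\<lambda>w. A (f w)) (\<lambda>w. B (f w))"
  by (simp add: MI_eq_ent ent_map_pmf assms)

text \<open>\<open>T\<close> is drawn from a kernel that looks at W but not at \<open>J\<close>. By
  the chain rule H(T|W,J) and H(T|W) are then the same average of kernel entropies, so their
  difference I(T;J|W) vanishes.\<close>

lemma CMI_adjoin_adjoin:
  fixes P :: "'w::countable pmf" and J :: "'w \<Rightarrow> 'j::countable pmf" and T :: "'w \<Rightarrow> 't::countable pmf"
  assumes b: "1 < b" and P: "finite (set_pmf P)"
    and J: "\<And>w. finite (set_pmf (J w))" and T: "\<And>w. finite (set_pmf (T w))"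
  defines "Q \<equiv> adjoin (adjoin P J) (\<lambda>x. T (fst x))"
  shows "CMI b Q snd (\<lambda>q. snd (fst q)) (\<lambda>q. fst (fst q)) = 0"
proof -
  note PJ = finite_set_pmf_adjoin[of P J, OF P J]
  note Q = finite_set_pmf_adjoin[of "adjoin P J" "\<lambda>x. T (fst x)", OF PJ T, folded Q_def]
  have WT: "map_pmf (\<lambda>q. (fst (fst q), snd q)) Q = adjoin P T"
    unfolding Q_def by (simp add: map_adjoin map_fst_adjoin)
  have WJ: "map_pmf fst Q = adjoin P J"
    unfolding Q_def by (rule map_fst_adjoin)
  have W: "map_pmf (\<lambda>q. fst (fst q)) Q = P"
    by (metis WJ map_fst_adjoin map_pmf_comp)
  \<comment> \<open>The integrand depends only on the first component, whose law under
    \<open>adjoin P J\<close> is \<open>P\<close>.\<close>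
  have E: "(\<integral>x. ent b (T (fst x)) (\<lambda>t. t) \<partial>adjoin P J) = (\<integral>w. ent b (T w) (\<lambda>t. t) \<partial>P)"
    by (subst (2) map_fst_adjoin[of P J, symmetric]) simp
  have "ent b Q (\<lambda>q. (snd q, fst (fst q))) = ent b Q (\<lambda>q. (fst (fst q), snd q))"
    by (rule ent_cong_kernel[OF b]) auto
  also have "\<dots> = ent b (adjoin P T) (\<lambda>x. x)"
    by (simp add: ent_map_pmf b flip: WT)
  finally have TW: "ent b Q (\<lambda>q. (snd q, fst (fst q))) = ent b (adjoin P T) (\<lambda>x. x)" .
  have "ent b Q (\<lambda>q. (snd (fst q), fst (fst q))) = ent b Q fst"
    by (rule ent_cong_kernel[OF b]) (auto simp: prod_eq_iff)
  also have "\<dots> = ent b (adjoin P J) (\<lambda>x. x)"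
    by (simp add: ent_map_pmf b flip: WJ)
  finally have JW: "ent b Q (\<lambda>q. (snd (fst q), fst (fst q))) = ent b (adjoin P J) (\<lambda>x. x)" .
  have TJW: "ent b Q (\<lambda>q. (snd q, snd (fst q), fst (fst q))) = ent b Q (\<lambda>x. x)"
    by (rule ent_cong_kernel[OF b]) (auto simp: prod_eq_iff)
  have W': "ent b Q (\<lambda>q. fst (fst q)) = ent b P (\<lambda>w. w)"
    using ent_map_pmf[OF b, of "\<lambda>q. fst (fst q)" Q "\<lambda>w. w"] by (simp add: W)
  have "ent b Q (\<lambda>x. x) = ent b (adjoin P J) (\<lambda>x. x) + (\<integral>w. ent b (T w) (\<lambda>t. t) \<partial>P)"
    unfolding Q_def by (simp add: ent_adjoin b PJ T E)
  moreover have "ent b (adjoin P T) (\<lambda>x. x) = ent b P (\<lambda>w. w) + (\<integral>w. ent b (T w) (\<lambda>t. t) \<partial>P)"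
    by (simp add: ent_adjoin b P T)
  ultimately show ?thesis
    unfolding CMI_eq_ent[OF b Q] TW JW TJW W' by simp
qed

lemma MI_le_CMI_add_CMI:
  fixes X :: "'w \<Rightarrow> 'x::countable" and Y :: "'w \<Rightarrow> 'y::countable" and Z :: "'w \<Rightarrow> 'z::countable"
    and J :: "'w \<Rightarrow> 'j::countable" and T :: "'w \<Rightarrow> 't::countable"
  assumes b: "1 < b" and fin: "finite (set_pmf p)"
    and TZ_XY: "CMI b p T Z (\<lambda>w. (X w, Y w)) = 0"
    and XY_T: "CMI b p X Y T = 0"
    and TZ: "MI b p T Z = 0"
    and TJ_XYZ: "CMI b p T J (\<lambda>w. (X w, Y w, Z w)) = 0"
  shows "MI b p X Y \<le> CMI b p X Y J + CMI b p (\<lambda>w. (X w, Y w)) J Z"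
proof -
  let ?h = "ent b p"
  note cmi = CMI_eq_ent[OF b fin] MI_eq_ent[OF b fin]
  \<comment> \<open>The first five are the terms of the expansion. In entropies alone it carries the
    extra term -I(T;J|X,Y); by the chain rule I(T;J|X,Y) + I(T;Z|X,Y,J) = I(T;Z|X,Y) + I(T;J|X,Y,Z)
    = 0, so the sixth inequality makes that term nonnegative.\<close>
  have sub: "0 \<le> CMI b p X Y (\<lambda>w. (T w, J w))" "0 \<le> CMI b p T J X" "0 \<le> CMI b p T J Y"
    "0 \<le> CMI b p (\<lambda>w. (X w, Y w)) J (\<lambda>w. (T w, Z w))" "0 \<le> CMI b p T Z J"
    "0 \<le> CMI b p T Z (\<lambda>w. (X w, Y w, J w))"
    by (rule CMI_nonneg[OF b fin])+
  \<comment> \<open>Each joint entropy gets one normal form, so that \<open>linarith\<close> treats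
    it as a single atom.\<close>
  have perm: "?h (\<lambda>w. (T w, X w, Y w)) = ?h (\<lambda>w. (X w, Y w, T w))"
    "?h (\<lambda>w. (Z w, X w, Y w)) = ?h (\<lambda>w. (X w, Y w, Z w))"
    "?h (\<lambda>w. (T w, X w, Y w, Z w)) = ?h (\<lambda>w. (T w, Z w, X w, Y w))"
    "?h (\<lambda>w. ((X w, Y w), Z w)) = ?h (\<lambda>w. (X w, Y w, Z w))"
    "?h (\<lambda>w. (J w, X w, Y w, Z w)) = ?h (\<lambda>w. ((X w, Y w), J w, Z w))"
    "?h (\<lambda>w. (T w, X w)) = ?h (\<lambda>w. (X w, T w))"
    "?h (\<lambda>w. (J w, X w)) = ?h (\<lambda>w. (X w, J w))"
    "?h (\<lambda>w. (T w, J w, X w)) = ?h (\<lambda>w. (X w, T w, J w))"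
    "?h (\<lambda>w. (T w, Y w)) = ?h (\<lambda>w. (Y w, T w))"
    "?h (\<lambda>w. (J w, Y w)) = ?h (\<lambda>w. (Y w, J w))"
    "?h (\<lambda>w. (T w, J w, Y w)) = ?h (\<lambda>w. (Y w, T w, J w))"
    "?h (\<lambda>w. ((X w, Y w), T w, Z w)) = ?h (\<lambda>w. (T w, Z w, X w, Y w))"
    "?h (\<lambda>w. ((X w, Y w), J w, T w, Z w)) = ?h (\<lambda>w. (T w, J w, X w, Y w, Z w))"
    "?h (\<lambda>w. (Z w, J w)) = ?h (\<lambda>w. (J w, Z w))"
    "?h (\<lambda>w. (T w, Z w, J w)) = ?h (\<lambda>w. (J w, T w, Z w))"
    "?h (\<lambda>w. (T w, X w, Y w, J w)) = ?h (\<lambda>w. (X w, Y w, T w, J w))"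
    "?h (\<lambda>w. (Z w, X w, Y w, J w)) = ?h (\<lambda>w. ((X w, Y w), J w, Z w))"
    "?h (\<lambda>w. (T w, Z w, X w, Y w, J w)) = ?h (\<lambda>w. (T w, J w, X w, Y w, Z w))"
    by (rule ent_cong_kernel[OF b]; auto)+
  show ?thesis
    using sub TZ_XY XY_T TZ TJ_XYZ unfolding cmi perm by linarith
qed

theorem theorem1:
  fixes b :: real
    and P :: "('x::finite \<times> 'y::finite \<times> 'z::finite) pmf"
    and T :: "'x \<times> 'y \<times> 'z \<Rightarrow> 't::finite pmf"
  assumes "b > 1"
    and "CMI b (adjoin P T) (\<lambda>((x, y, z), t). t) (\<lambda>((x, y, z), t). z) (\<lambda>((x, y, z), t). (x, y)) = 0"
    and "CMI b (adjoin P T) (\<lambda>((x, y, z), t). x) (\<lambda>((x, y, z), t). y) (\<lambda>((x, y, z), t). t) = 0"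
    and "MI b (adjoin P T) (\<lambda>((x, y, z), t). t) (\<lambda>((x, y, z), t). z) = 0"
  shows "psi_hat b P = MI b P (\<lambda>(x, y, z). x) (\<lambda>(x, y, z). y)"
proof -
  note b = assms(1)
  have finP: "finite (set_pmf P)"
    by simp
  \<comment> \<open>Projections replace tuple patterns, matching the form that
    \<open>case_prod_beta'\<close> produces.\<close>
  let ?X = "\<lambda>w :: 'x \<times> 'y \<times> 'z. fst w" and ?Y = "\<lambda>w :: 'x \<times> 'y \<times> 'z. fst (snd w)"
    and ?Z = "\<lambda>w :: 'x \<times> 'y \<times> 'z. snd (snd w)"
  let ?obj = "\<lambda>J :: 'x \<times> 'y \<times> 'z \<Rightarrow> nat pmf.
      CMI b (adjoin P J) (\<lambda>p. ?X (fst p)) (\<lambda>p. ?Y (fst p)) snd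
    + CMI b (adjoin P J) (\<lambda>p. (?X (fst p), ?Y (fst p))) snd (\<lambda>p. ?Z (fst p))"
  have lower: "MI b P ?X ?Y \<le> ?obj J" if J: "\<forall>w. finite (set_pmf (J w))" for J
  proof -
    \<comment> \<open>A coupling of \<open>J\<close> and \<open>T\<close> over
      \<open>(X,Y,Z)\<close>: its marginals are \<open>adjoin P J\<close> and
      \<open>adjoin P T\<close>, so the objective and the hypotheses on \<open>T\<close> can be
      compared on one sample space.\<close>
    define Q where "Q = adjoin (adjoin P J) (\<lambda>x. T (fst x))"
    have finQ: "finite (set_pmf Q)"
      unfolding Q_def using J by (intro finite_set_pmf_adjoin) auto
    have PJ: "adjoin P J = map_pmf fst Q"
      unfolding Q_def by (rule map_fst_adjoin[symmetric])
    have PT: "adjoin P T = map_pmf (\<lambda>q. (fst (fst q), snd q)) Q"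
      unfolding Q_def by (simp add: map_adjoin map_fst_adjoin)
    have PQ: "P = map_pmf (\<lambda>q. fst (fst q)) Q"
      by (metis PJ map_fst_adjoin map_pmf_comp)
    have "CMI b Q snd (\<lambda>q. snd (fst q)) (\<lambda>q. fst (fst q)) = 0"
      unfolding Q_def by (rule CMI_adjoin_adjoin) (use b J in auto)
    then show ?thesis
      using assms(2-4) MI_le_CMI_add_CMI[OF b finQ, of snd "\<lambda>q. ?Z (fst (fst q))"
          "\<lambda>q. ?X (fst (fst q))" "\<lambda>q. ?Y (fst (fst q))" "\<lambda>q. snd (fst q)"]
      unfolding PT PJ by (subst PQ) (simp add: case_prod_beta' CMI_map_pmf MI_map_pmf b finQ)
  qed
  have attained: "MI b P ?X ?Y = ?obj (\<lambda>_. return_pmf 0)"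
  proof -
    have PJ: "adjoin P (\<lambda>_. return_pmf 0) = map_pmf (\<lambda>w. (w, 0 :: nat)) P"
      by (simp add: adjoin_def map_pmf_def bind_return_pmf)
    \<comment> \<open>A constant component does not refine the partition; hence conditioning on the
      constant \<open>J\<close> changes nothing, and I(X,Y;J|Z) cancels to 0.\<close>
    have drop: "ent b P (\<lambda>w. (A w, 0 :: nat)) = ent b P A"
      "ent b P (\<lambda>w. (0 :: nat, A w)) = ent b P A"
      "ent b P (\<lambda>w. (B w, A w, 0 :: nat)) = ent b P (\<lambda>w. (B w, A w))"
      "ent b P (\<lambda>w. (B w, 0 :: nat, A w)) = ent b P (\<lambda>w. (B w, A w))"
      for A :: "'x \<times> 'y \<times> 'z \<Rightarrow> 'e" and B :: "'x \<times> 'y \<times> 'z \<Rightarrow> 'f"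
      by (rule ent_cong_kernel[OF b]; simp)+
    show ?thesis
      unfolding PJ CMI_map_pmf[OF b finP]
      by (simp add: CMI_eq_ent MI_eq_ent ent_const drop b)
  qed
  have "psi_hat b P = MI b P ?X ?Y"
    unfolding psi_hat_def case_prod_beta'
  proof (rule Least_equality)
    show "\<exists>J. (\<forall>w. finite (set_pmf (J w))) \<and> MI b P ?X ?Y = ?obj J"
      using attained by (intro exI[of _ "\<lambda>_. return_pmf 0"]) simp
  next
    fix v
    assume "\<exists>J. (\<forall>w. finite (set_pmf (J w))) \<and> v = ?obj J"
    then show "MI b P ?X ?Y \<le> v"
      using lower by blast
  qed
  then show ?thesis
    by (simp add: case_prod_beta')
qed

end
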